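(* For every nonnegative integer $h$ there exists a graph $G$ with obstacle number ${\rm obs}(G)$ exactly $h$.
   Context: An obstacle representation of a graph $G$ consists of a set $P$ of points in the plane, one for each vertex of $G$, together with a set of closed polygonal obstacles (connected polygonal regions) such that the points of $P$ and the vertices of the obstacles are in general position (no three on a line), and such that two vertices of $G$ are adjacent if and only if the segment connecting the corresponding points does not meet any obstacle. The obstacle number ${\rm obs}(G)$ is the minimum number of obstacles in an obstacle representation of $G$. *)

theory Defs
  imports "HOL-Analysis.Analysis" "HOL-Library.Extended_Nat" "Graph_Theory.Pair_Digraph"
begin

text \<open>
  Graphs are finite, simple and undirected, i.e. instances of the locale \<open>pair_graph\<close>: both
  \<open>(u, v)\<close> and \<open>(v, u)\<close> belong to \<open>parcs G\<close> when \<open>u\<close> and \<open>v\<close> are adjacent.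
\<close>

definition polygonal_region :: "(real^2) set \<Rightarrow> bool" where
  "polygonal_region S \<longleftrightarrow>
     (\<exists>\<T>. finite \<T> \<and> \<T> \<noteq> {} \<and> (\<forall>T\<in>\<T>. 2 simplex T) \<and> S = \<Union>\<T>)"

definition polygonal_obstacle :: "(real^2) set \<Rightarrow> bool" where
  "polygonal_obstacle S \<longleftrightarrow> polygonal_region S \<and> connected S"

text \<open>
  The vertices of a polygonal region are the points of its boundary near which the boundary is
  not a straight line. They do not depend on the decomposition into triangles, and those on the
  boundary of a hole are included.
\<close>

definition region_vertices :: "(real^2) set \<Rightarrow> (real^2) set" where
  "region_vertices S = {v \<in> frontier S.
     \<not> (\<exists>e>0. \<exists>w. w \<noteq> v \<and> frontier S \<inter> ball v e = affine hull {v, w} \<inter> ball v e)}"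

definition general_position :: "(real^2) set \<Rightarrow> bool" where
  "general_position X \<longleftrightarrow>
     (\<forall>x\<in>X. \<forall>y\<in>X. \<forall>z\<in>X. x \<noteq> y \<and> y \<noteq> z \<and> x \<noteq> z \<longrightarrow> \<not> collinear {x, y, z})"

definition obstacle_representation ::
    "'a pair_pre_digraph \<Rightarrow> ('a \<Rightarrow> real^2) \<Rightarrow> (real^2) set set \<Rightarrow> bool" where
  "obstacle_representation G p \<O> \<longleftrightarrow>
     inj_on p (pverts G) \<and>
     finite \<O> \<and> (\<forall>S\<in>\<O>. polygonal_obstacle S) \<and>
     general_position (p ` pverts G \<union> (\<Union>S\<in>\<O>. region_vertices S)) \<and>
     (\<forall>u\<in>pverts G. \<forall>v\<in>pverts G. u \<noteq> v \<longrightarrow>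
        ((u, v) \<in> parcs G \<longleftrightarrow> (\<forall>S\<in>\<O>. closed_segment (p u) (p v) \<inter> S = {})))"

text \<open>The value is \<open>\<infinity>\<close> for a graph without any obstacle representation.\<close>

definition obs :: "'a pair_pre_digraph \<Rightarrow> enat" where
  "obs G = (INF \<O> \<in> {\<O>. \<exists>p. obstacle_representation G p \<O>}. enat (card \<O>))"

end

theory Submission
  imports Defs
begin

text \<open>
  If \<open>u\<close>, \<open>v\<close> are non-adjacent and have common neighbours \<open>a\<close>, \<open>b\<close> on different sides of the line
  \<open>uv\<close>, then an obstacle meeting the segment \<open>uv\<close> is trapped in the quadrilateral \<open>uavb\<close>. There is a
  graph on 11 vertices having such a quadruple in every placement. In every placement of its
  lexicographic power of exponent \<open>2h\<close> a sweep finds \<open>h\<close> such quadruples with disjoint convex hulls,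
  so the obstacle number of this power is at least \<open>h\<close>.

  Deleting an edge increases the obstacle number by at most one, since the edge can be blocked by a
  small generic triangle. Starting with a complete graph, whose obstacle number is 0, and deleting
  edges until the lexicographic power is reached, the obstacle number therefore takes the value \<open>h\<close>.
\<close>

section \<open>Orientation\<close>

definition orient :: "real^2 \<Rightarrow> real^2 \<Rightarrow> real^2 \<Rightarrow> real" where
  "orient a b c = (b$1 - a$1) * (c$2 - a$2) - (b$2 - a$2) * (c$1 - a$1)"

definition left_normal :: "real^2 \<Rightarrow> real^2 \<Rightarrow> real^2" where
  "left_normal a b = vector [a$2 - b$2, b$1 - a$1]"

definition same_side :: "real^2 \<Rightarrow> real^2 \<Rightarrow> real^2 \<Rightarrow> real^2 \<Rightarrow> bool" where
  "same_side a b x y \<longleftrightarrow> orient a b x * orient a b y > 0"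

lemma vec2_eq_iff: "x = y \<longleftrightarrow> x$1 = y$1 \<and> x$2 = y$2" for x y :: "'a^2"
  by (simp add: vec_eq_iff forall_2)

lemma inner_vec2: "x \<bullet> y = x$1 * y$1 + x$2 * y$2" for x y :: "real^2"
  by (simp add: inner_vec_def sum_2)

lemma orient_rotate: "orient b c a = orient a b c"
  by (simp add: orient_def algebra_simps)

lemma orient_swap: "orient b a c = - orient a b c"
  by (simp add: orient_def algebra_simps)

lemma orient_swap_right: "orient a c b = - orient a b c"
  by (simp add: orient_def algebra_simps)

lemma orient_degenerate [simp]: "orient a a b = 0" "orient a b a = 0" "orient a b b = 0"
  by (simp_all add: orient_def)

lemma orient_eq_inner: "orient a b c = left_normal a b \<bullet> (c - a)"
  by (simp add: orient_def left_normal_def inner_vec2 algebra_simps)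

lemma left_normal_eq_0_iff [simp]: "left_normal a b = 0 \<longleftrightarrow> a = b"
  by (auto simp: left_normal_def vec2_eq_iff)

lemma norm_left_normal: "norm (left_normal a b) = dist a b"
  by (simp add: left_normal_def dist_norm norm_eq_sqrt_inner inner_vec2 algebra_simps)

lemma orient_eq_0_hyperplane:
  "{x. orient a b x = 0} = {x. left_normal a b \<bullet> x = left_normal a b \<bullet> a}"
  by (simp add: orient_eq_inner inner_diff_right)

lemma collinear_iff_orient: "collinear {a, b, c} \<longleftrightarrow> orient a b c = 0"
proof -
  have "collinear {b, a, c} \<longleftrightarrow> collinear {0, b - a, c - a}"
    by (rule collinear_3) (simp add: NO_MATCH_def)
  then have "collinear {a, b, c} \<longleftrightarrow> b = a \<or> c = a \<or> (\<exists>k. c - a = k *\<^sub>R (b - a))"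
    by (simp add: insert_commute collinear_lemma)
  also have "\<dots> \<longleftrightarrow> orient a b c = 0"
  proof
    assume "b = a \<or> c = a \<or> (\<exists>k. c - a = k *\<^sub>R (b - a))"
    then show "orient a b c = 0"
      by (auto simp: orient_def vec2_eq_iff)
  next
    assume zero: "orient a b c = 0"
    consider "b = a" | "b$1 \<noteq> a$1" | "b$2 \<noteq> a$2" by (auto simp: vec2_eq_iff)
    then show "b = a \<or> c = a \<or> (\<exists>k. c - a = k *\<^sub>R (b - a))"
    proof cases
      case 2
      then have "c - a = ((c$1 - a$1) / (b$1 - a$1)) *\<^sub>R (b - a)"
        using zero by (simp add: vec2_eq_iff orient_def eq_divide_eq mult.commute)
      then show ?thesis by blast
    next
      case 3
      then have "c - a = ((c$2 - a$2) / (b$2 - a$2)) *\<^sub>R (b - a)"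
        using zero by (simp add: vec2_eq_iff orient_def eq_divide_eq mult.commute)
      then show ?thesis by blast
    qed simp
  qed
  finally show ?thesis .
qed

lemma affine_hull_2_eq_orient: "a \<noteq> b \<Longrightarrow> affine hull {a, b} = {x. orient a b x = 0}"
  using collinear_3_affine_hull[of a b] by (auto simp: collinear_iff_orient)

lemma orient_barycentric:
  "orient u v a *\<^sub>R z = orient v a z *\<^sub>R u + orient a u z *\<^sub>R v + orient u v z *\<^sub>R a"
  by (simp add: vec2_eq_iff orient_def algebra_simps)

lemma orient_barycentric_sum: "orient v a z + orient a u z + orient u v z = orient u v a"
  by (simp add: orient_def algebra_simps)

lemma continuous_on_orient [continuous_intros]: "continuous_on S (orient a b)"
  unfolding orient_def[abs_def] by (intro continuous_intros)

lemma mem_triangle_iff_orient: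
  assumes "orient u v a > 0"
  shows "z \<in> convex hull {u, v, a} \<longleftrightarrow> orient v a z \<ge> 0 \<and> orient a u z \<ge> 0 \<and> orient u v z \<ge> 0"
proof
  assume "z \<in> convex hull {u, v, a}"
  then obtain r s t where z: "z = r *\<^sub>R u + s *\<^sub>R v + t *\<^sub>R a"
    and nonneg: "r \<ge> 0" "s \<ge> 0" "t \<ge> 0" and sum: "r + s + t = 1"
    unfolding convex_hull_3 by auto
  have r: "r = 1 - s - t" using sum by simp
  have "orient v a z = r * orient u v a" "orient a u z = s * orient u v a"
    "orient u v z = t * orient u v a"
    unfolding z r by (simp_all add: orient_def algebra_simps)
  then show "orient v a z \<ge> 0 \<and> orient a u z \<ge> 0 \<and> orient u v z \<ge> 0"
    using nonneg assms by simp
next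
  let ?D = "orient u v a"
  assume nonneg: "orient v a z \<ge> 0 \<and> orient a u z \<ge> 0 \<and> orient u v z \<ge> 0"
  have "z = (1 / ?D) *\<^sub>R (?D *\<^sub>R z)" using assms by simp
  also have "\<dots> = (orient v a z / ?D) *\<^sub>R u + (orient a u z / ?D) *\<^sub>R v + (orient u v z / ?D) *\<^sub>R a"
    by (subst orient_barycentric) (simp add: scaleR_add_right divide_inverse mult.commute)
  finally have "z = \<dots>" .
  moreover have "orient v a z / ?D + orient a u z / ?D + orient u v z / ?D = 1"
    using orient_barycentric_sum[of v a z u] assms by (simp add: add_divide_distrib[symmetric])
  ultimately show "z \<in> convex hull {u, v, a}"
    unfolding convex_hull_3 using nonneg assms by (blast intro: divide_nonneg_pos)
qed

lemma same_side_sym: "same_side a b x y \<longleftrightarrow> same_side a b y x"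
  by (simp add: same_side_def mult.commute)

lemma same_side_swap: "same_side a b x y \<longleftrightarrow> same_side b a x y"
  by (simp add: same_side_def orient_swap[of b a])

lemma same_side_trans: "\<lbrakk>same_side a b x y; same_side a b y z\<rbrakk> \<Longrightarrow> same_side a b x z"
  by (auto simp: same_side_def zero_less_mult_iff)

lemma convex_same_side: "convex {x. same_side a b k x}"
proof -
  have "{x. same_side a b k x} =
      {x. (orient a b k *\<^sub>R left_normal a b) \<bullet> x > orient a b k * (left_normal a b \<bullet> a)}"
    by (simp add: same_side_def orient_eq_inner[of a b] inner_diff_right right_diff_distrib)
  then show ?thesis by (simp only: convex_halfspace_gt)
qed

lemma notin_triangle_if_same_side:
  assumes "same_side r s k u" "same_side r s k v"
  shows "r \<notin> convex hull {k, u, v}"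
proof -
  have "same_side r s k k"
    using assms(1) same_side_trans same_side_sym by blast
  then have "convex hull {k, u, v} \<subseteq> {x. same_side r s k x}"
    using assms by (intro hull_minimal convex_same_side) simp
  moreover have "\<not> same_side r s k r" by (simp add: same_side_def)
  ultimately show ?thesis by blast
qed

section \<open>Trapped quadruples\<close>

lemma open_segment_subset_interior_triangles:
  assumes a: "orient u v a > 0" and b: "orient u v b < 0"
  shows "open_segment u v \<subseteq> interior (convex hull {u, v, a} \<union> convex hull {v, u, b})"
    (is "_ \<subseteq> interior ?Q")
proof
  fix x assume "x \<in> open_segment u v"
  then obtain t where x: "x = (1 - t) *\<^sub>R u + t *\<^sub>R v" and t: "0 < t" "t < 1"
    by (auto simp: in_segment)
  define W where "W = {z. orient v a z > 0 \<and> orient a u z > 0 \<and> orient u b z > 0 \<and> orient b v z > 0}"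
  have b': "orient v u b > 0" using b by (simp add: orient_swap[of v])
  have "orient v a x = (1 - t) * orient u v a" "orient a u x = t * orient u v a"
    "orient u b x = t * orient v u b" "orient b v x = (1 - t) * orient v u b"
    unfolding x by (simp_all add: orient_def algebra_simps)
  then have "x \<in> W" using a b' t by (simp add: W_def)
  moreover have "W \<subseteq> ?Q"
  proof
    fix z assume "z \<in> W"
    then show "z \<in> ?Q"
      using orient_swap[of v u z]
      by (cases "orient u v z \<ge> 0")
        (simp_all add: W_def mem_triangle_iff_orient[OF a] mem_triangle_iff_orient[OF b'])
  qed
  moreover have "open W"
    unfolding W_def by (intro open_Collect_conj open_Collect_less continuous_intros)
  ultimately show "x \<in> interior ?Q" by (rule interiorI[rotated])
qed

lemma frontier_quadrilateral_subset:
  assumes "orient u v a > 0" "orient u v b < 0"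
  shows "frontier (convex hull {u, v, a} \<union> convex hull {v, u, b}) \<subseteq>
    closed_segment u a \<union> closed_segment v a \<union> closed_segment u b \<union> closed_segment v b"
    (is "frontier ?Q \<subseteq> ?sides")
proof
  fix x assume x: "x \<in> frontier ?Q"
  have dim: "DIM(real^2) = 2" by simp
  have "frontier ?Q \<subseteq> frontier (convex hull {u, v, a}) \<union> frontier (convex hull {v, u, b})"
    by (rule frontier_Un_subset)
  also have "\<dots> = ?sides \<union> closed_segment u v"
    unfolding frontier_of_triangle[OF dim]
    unfolding closed_segment_commute[of a u] closed_segment_commute[of b v]
      closed_segment_commute[of v u]
    by blast
  finally have "x \<in> ?sides \<union> closed_segment u v" using x by blast
  moreover have "x \<notin> open_segment u v"
    using x open_segment_subset_interior_triangles[OF assms] unfolding frontier_def by blast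
  moreover have "{u, v} \<subseteq> ?sides" by simp
  ultimately show "x \<in> ?sides"
    unfolding open_segment_def by blast
qed

lemma connected_subset_quadrilateral:
  assumes a: "orient u v a > 0" and b: "orient u v b < 0"
    and S: "connected S" "closed_segment u v \<inter> S \<noteq> {}"
    and avoid: "closed_segment u a \<inter> S = {}" "closed_segment v a \<inter> S = {}"
      "closed_segment u b \<inter> S = {}" "closed_segment v b \<inter> S = {}"
  shows "S \<subseteq> convex hull {u, v, a, b}"
proof -
  let ?Q = "convex hull {u, v, a} \<union> convex hull {v, u, b}"
  have "closed_segment u v \<subseteq> ?Q"
    unfolding segment_convex_hull by (intro le_supI1 hull_mono) blast
  then have "S \<inter> ?Q \<noteq> {}" using S(2) by blast
  moreover have "S \<inter> frontier ?Q = {}"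
    using frontier_quadrilateral_subset[OF a b] avoid by blast
  ultimately have "S \<subseteq> ?Q" using connected_Int_frontier[OF S(1), of ?Q] by blast
  also have "\<dots> \<subseteq> convex hull {u, v, a, b}"
    by (intro Un_least hull_mono) auto
  finally show ?thesis .
qed

definition generic_on :: "'v set \<Rightarrow> ('v \<Rightarrow> real^2) \<Rightarrow> bool" where
  "generic_on V p \<longleftrightarrow> inj_on p V \<and> general_position (p ` V)"

definition trapped :: "('v \<Rightarrow> 'v \<Rightarrow> bool) \<Rightarrow> ('v \<Rightarrow> real^2) \<Rightarrow> 'v \<Rightarrow> 'v \<Rightarrow> 'v \<Rightarrow> 'v \<Rightarrow> bool" where
  "trapped adj p u v a b \<longleftrightarrow> \<not> adj u v \<and> adj u a \<and> adj v a \<and> adj u b \<and> adj v b \<and>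
     orient (p u) (p v) (p a) > 0 \<and> orient (p u) (p v) (p b) < 0"

definition trap_hulls :: "'v set \<Rightarrow> ('v \<Rightarrow> 'v \<Rightarrow> bool) \<Rightarrow> ('v \<Rightarrow> real^2) \<Rightarrow> (real^2) set set" where
  "trap_hulls V adj p =
     {convex hull {p u, p v, p a, p b} | u v a b. {u, v, a, b} \<subseteq> V \<and> trapped adj p u v a b}"

definition forces_trap :: "'v set \<Rightarrow> ('v \<Rightarrow> 'v \<Rightarrow> bool) \<Rightarrow> bool" where
  "forces_trap V adj \<longleftrightarrow> (\<forall>p. generic_on V p \<longrightarrow> trap_hulls V adj p \<noteq> {})"

lemma general_position_mono: "\<lbrakk>general_position Y; X \<subseteq> Y\<rbrakk> \<Longrightarrow> general_position X"
  unfolding general_position_def by blast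

lemma general_position_orient:
  "\<lbrakk>general_position X; x \<in> X; y \<in> X; z \<in> X; x \<noteq> y; y \<noteq> z; x \<noteq> z\<rbrakk> \<Longrightarrow> orient x y z \<noteq> 0"
  unfolding general_position_def collinear_iff_orient by blast

lemma generic_on_orient:
  assumes "generic_on V p" "x \<in> V" "y \<in> V" "z \<in> V" "x \<noteq> y" "y \<noteq> z" "x \<noteq> z"
  shows "orient (p x) (p y) (p z) \<noteq> 0"
proof -
  have inj: "inj_on p V" and gp: "general_position (p ` V)"
    using assms(1) by (simp_all add: generic_on_def)
  show ?thesis
    by (rule general_position_orient[OF gp]) (simp_all add: inj_on_eq_iff[OF inj] assms)
qed

lemma generic_on_reindex:
  assumes "generic_on V p" "inj_on c U" "c ` U \<subseteq> V"
  shows "generic_on U (\<lambda>x. p (c x))"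
proof -
  have inj: "inj_on p V" and gp: "general_position (p ` V)"
    using assms(1) by (simp_all add: generic_on_def)
  have "inj_on (\<lambda>x. p (c x)) U"
    using comp_inj_on[OF assms(2) inj_on_subset[OF inj assms(3)]] by (simp add: comp_def)
  moreover have "general_position ((\<lambda>x. p (c x)) ` U)"
    by (rule general_position_mono[OF gp]) (use assms(3) in auto)
  ultimately show ?thesis by (simp add: generic_on_def)
qed

lemma trapped_distinct:
  "trapped adj p u v a b \<Longrightarrow> u \<noteq> v \<and> u \<noteq> a \<and> v \<noteq> a \<and> u \<noteq> b \<and> v \<noteq> b"
  by (auto simp: trapped_def)

lemma trap_hulls_reindex:
  assumes "c ` U \<subseteq> V"
    and adj: "\<And>x y. \<lbrakk>x \<in> U; y \<in> U; x \<noteq> y\<rbrakk> \<Longrightarrow> adj' (c x) (c y) \<longleftrightarrow> adj x y"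
  shows "trap_hulls U adj (\<lambda>x. p (c x)) \<subseteq> trap_hulls V adj' p"
proof
  fix C assume "C \<in> trap_hulls U adj (\<lambda>x. p (c x))"
  then obtain u v a b where sub: "{u, v, a, b} \<subseteq> U"
    and tr: "trapped adj (\<lambda>x. p (c x)) u v a b"
    and C: "C = convex hull {p (c u), p (c v), p (c a), p (c b)}"
    unfolding trap_hulls_def by auto
  have "trapped adj' p (c u) (c v) (c a) (c b)"
    using tr trapped_distinct[OF tr] sub adj by (simp add: trapped_def)
  moreover have "{c u, c v, c a, c b} \<subseteq> V" using sub assms(1) by auto
  ultimately show "C \<in> trap_hulls V adj' p" unfolding trap_hulls_def C by blast
qed

lemma trap_hulls_nonempty: "C \<in> trap_hulls V adj p \<Longrightarrow> C \<noteq> {}"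
  by (auto simp: trap_hulls_def)

lemma trap_hulls_subset_hull:
  assumes "C \<in> trap_hulls V adj p"
  shows "C \<subseteq> convex hull (p ` V)"
proof -
  obtain u v a b where "{u, v, a, b} \<subseteq> V" and C: "C = convex hull {p u, p v, p a, p b}"
    using assms unfolding trap_hulls_def by blast
  then show ?thesis unfolding C by (intro hull_mono) simp
qed

lemma same_side_if_no_trap:
  assumes "generic_on V p" "trap_hulls V adj p = {}" "irreflp adj"
    and V: "{u, v, a, b} \<subseteq> V" and "u \<noteq> v" "\<not> adj u v"
    and adj: "adj u a" "adj v a" "adj u b" "adj v b"
  shows "same_side (p u) (p v) (p a) (p b)"
proof -
  have "u \<noteq> a" "v \<noteq> a" "u \<noteq> b" "v \<noteq> b"
    using adj \<open>irreflp adj\<close> by (auto dest: irreflpD)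
  then have "orient (p u) (p v) (p a) \<noteq> 0" "orient (p u) (p v) (p b) \<noteq> 0"
    using V \<open>u \<noteq> v\<close> by (simp_all add: generic_on_orient[OF assms(1)])
  moreover have "\<not> trapped adj p u v a b" "\<not> trapped adj p u v b a"
    using assms(2) V unfolding trap_hulls_def by blast+
  ultimately show ?thesis
    using adj \<open>\<not> adj u v\<close> by (auto simp: same_side_def trapped_def zero_less_mult_iff neq_iff)
qed

section \<open>A graph with a trapped quadruple in every placement\<close>

definition cot_angle :: "real^2 \<Rightarrow> real^2 \<Rightarrow> real^2 \<Rightarrow> real" where
  "cot_angle k l x = ((l - k) \<bullet> (x - k)) / orient k l x"

lemma cot_angle_less_iff:
  assumes "orient k l x > 0" "orient k l y > 0"
  shows "cot_angle k l y < cot_angle k l x \<longleftrightarrow> orient k x y > 0"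
proof -
  have "k \<noteq> l" using assms(1) by auto
  then have pos: "(l - k) \<bullet> (l - k) > 0" by simp
  have "cot_angle k l y < cot_angle k l x \<longleftrightarrow>
      ((l - k) \<bullet> (y - k)) * orient k l x < ((l - k) \<bullet> (x - k)) * orient k l y"
    using assms by (simp add: cot_angle_def field_simps)
  also have "\<dots> \<longleftrightarrow> ((l - k) \<bullet> (l - k)) * orient k x y > 0"
    by (simp add: inner_vec2 orient_def algebra_simps)
  also have "\<dots> \<longleftrightarrow> orient k x y > 0"
    using mult_less_cancel_left_pos[OF pos, of 0] by simp
  finally show ?thesis .
qed

lemma not_angularly_between:
  assumes half: "orient k l u > 0" "orient k l v > 0" "orient k l r > 0"
    and side: "same_side u v k r" "same_side r s k u" "same_side r s k v"
    and less: "cot_angle k l v < cot_angle k l u"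
  shows "cot_angle k l r < cot_angle k l v \<or> cot_angle k l u < cot_angle k l r"
proof (rule ccontr)
  assume "\<not> ?thesis"
  then have "orient k v r \<le> 0" "orient k r u \<le> 0"
    by (simp_all add: cot_angle_less_iff half not_less)
  moreover have pos: "orient k u v > 0"
    using less by (simp add: cot_angle_less_iff half)
  moreover have "orient u v r > 0"
    using side(1) pos by (simp add: same_side_def orient_rotate zero_less_mult_iff)
  ultimately have "r \<in> convex hull {k, u, v}"
    using orient_swap_right[of k u r] orient_rotate[of r v k] orient_swap_right[of k r v]
      orient_rotate[of v k r]
    by (simp add: mem_triangle_iff_orient)
  then show False using notin_triangle_if_same_side[OF side(2,3)] by blast
qed

definition separated :: "'a::linorder \<Rightarrow> 'a \<Rightarrow> 'a \<Rightarrow> 'a \<Rightarrow> bool" where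
  "separated a b c d \<longleftrightarrow> max a b < min c d \<or> max c d < min a b"

lemma angularly_separated:
  assumes half: "orient k l u > 0" "orient k l v > 0" "orient k l r > 0" "orient k l s > 0"
    and uv: "same_side u v k r" "same_side u v k s"
    and rs: "same_side r s k u" "same_side r s k v"
  shows "separated (cot_angle k l u) (cot_angle k l v) (cot_angle k l r) (cot_angle k l s)"
proof -
  have outside: "cot_angle k l z < min (cot_angle k l x) (cot_angle k l y) \<or>
      max (cot_angle k l x) (cot_angle k l y) < cot_angle k l z"
    if "orient k l x > 0" "orient k l y > 0" "orient k l z > 0"
      and "same_side x y k z" "same_side z w k x" "same_side z w k y" for x y z w
  proof -
    have "orient k x y \<noteq> 0"
      using that(4) orient_rotate[of x y k] by (auto simp: same_side_def)
    then consider "orient k x y > 0" | "orient k y x > 0"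
      using orient_swap_right[of k y x] by (cases "orient k x y > 0") auto
    then show ?thesis
    proof cases
      case 1
      then show ?thesis
        using not_angularly_between[of k l x y z w] that by (auto simp: cot_angle_less_iff)
    next
      case 2
      then show ?thesis
        using not_angularly_between[of k l y x z w] that
        by (auto simp: cot_angle_less_iff same_side_swap[of y x])
    qed
  qed
  show ?thesis
    using outside[of u v r s] outside[of u v s r] outside[of r s u v] outside[of r s v u] half uv rs
    unfolding separated_def by (auto simp: same_side_swap[of s r] same_side_swap[of v u])
qed

lemma no_separated_cycle:
  fixes t :: "nat \<Rightarrow> 'a::linorder"
  assumes sep: "\<And>i d. \<lbrakk>i < 9; d \<in> {3, 4, 5}\<rbrakk>
    \<Longrightarrow> separated (t i) (t ((i + 1) mod 9)) (t ((i + d) mod 9)) (t ((i + d + 1) mod 9))"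
  shows False
proof -
  have "max (t 0) (t 1) < min (t 3) (t 6) \<or> max (t 3) (t 6) < min (t 0) (t 1)"
    using sep[of 0 3] sep[of 0 4] sep[of 0 5] by (auto simp: separated_def)
  moreover have "max (t 3) (t 4) < min (t 6) (t 0) \<or> max (t 6) (t 0) < min (t 3) (t 4)"
    using sep[of 3 3] sep[of 3 4] sep[of 3 5] by (auto simp: separated_def)
  moreover have "max (t 6) (t 7) < min (t 0) (t 3) \<or> max (t 0) (t 3) < min (t 6) (t 7)"
    using sep[of 6 3] sep[of 6 4] sep[of 6 5] by (auto simp: separated_def numeral_2_eq_2)
  ultimately show False by auto
qed

text \<open>
  The complement of the disjoint union of the 9-cycle \<open>0, \<dots>, 8\<close> and the edge \<open>{9, 10}\<close>. If no
  quadruple is trapped, then the cycle lies on one side of the line through \<open>9\<close> and \<open>10\<close>, and seen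
  from one of these two points any two cycle edges at distance at least two span disjoint angles.
  But no three intervals can be the images of \<open>01\<close>, \<open>34\<close>, \<open>67\<close>: the one in the middle would separate
  the other two, which are joined by a path of edges far from it.
\<close>

definition kernel_adj :: "nat \<Rightarrow> nat \<Rightarrow> bool" where
  "kernel_adj x y \<longleftrightarrow> x \<noteq> y \<and> {x, y} \<noteq> {9, 10} \<and>
     \<not> (x < 9 \<and> y < 9 \<and> (y = (x + 1) mod 9 \<or> x = (y + 1) mod 9))"

lemma symp_kernel_adj: "symp kernel_adj"
  by (auto simp: symp_def kernel_adj_def insert_commute)

lemma irreflp_kernel_adj: "irreflp kernel_adj"
  by (simp add: irreflp_def kernel_adj_def)

lemma kernel_adj_far_edges:
  assumes "i < 9" "d \<in> {3, 4, 5}"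
    and "x \<in> {i, (i + 1) mod 9}" "y \<in> {(i + d) mod 9, (i + d + 1) mod 9}"
  shows "kernel_adj x y"
proof -
  have "x < 9" "y < 9" using assms by auto
  moreover have "i \<in> {0, 1, 2, 3, 4, 5, 6, 7, 8}" using assms(1) by auto
  then have "x \<noteq> y \<and> y \<noteq> (x + 1) mod 9 \<and> x \<noteq> (y + 1) mod 9"
    using assms(2-) by (elim insertE emptyE) simp_all
  ultimately show ?thesis by (auto simp: kernel_adj_def doubleton_eq_iff)
qed

lemma cycle_on_one_side_if_no_trap:
  assumes "generic_on {..<11} q" "trap_hulls {..<11} kernel_adj q = {}"
  obtains k l where "{k, l} = {9, 10}" "\<And>i. i < 9 \<Longrightarrow> orient (q k) (q l) (q i) > 0"
proof -
  have same: "same_side (q 9) (q 10) (q i) (q 0)" if "i < 9" for i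
    by (rule same_side_if_no_trap[OF assms irreflp_kernel_adj])
      (use that in \<open>auto simp: kernel_adj_def doubleton_eq_iff\<close>)
  show thesis
  proof (cases "orient (q 9) (q 10) (q 0) > 0")
    case True
    then show ?thesis
      using same by (intro that[of 9 10]) (auto simp: same_side_def zero_less_mult_iff)
  next
    case False
    then show ?thesis
      using same orient_swap[of "q 10" "q 9"]
      by (intro that[of 10 9]) (auto simp: same_side_def zero_less_mult_iff)
  qed
qed

lemma forces_trap_kernel: "forces_trap {..<11} kernel_adj"
  unfolding forces_trap_def
proof (intro allI impI notI)
  fix q :: "nat \<Rightarrow> real^2"
  assume gen: "generic_on {..<11} q" and no_trap: "trap_hulls {..<11} kernel_adj q = {}"
  note same = same_side_if_no_trap[OF gen no_trap irreflp_kernel_adj]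
  obtain k l where kl: "{k, l} = {9, 10}" and half: "\<And>i. i < 9 \<Longrightarrow> orient (q k) (q l) (q i) > 0"
    using cycle_on_one_side_if_no_trap[OF gen no_trap] by metis
  have k: "k < 11" "kernel_adj x k" if "x < 9" for x
    using kl that by (auto simp: kernel_adj_def doubleton_eq_iff)
  define t where "t i = cot_angle (q k) (q l) (q i)" for i
  have "separated (t i) (t ((i + 1) mod 9)) (t ((i + d) mod 9)) (t ((i + d + 1) mod 9))"
    if i: "i < 9" and d: "d \<in> {3, 4, 5}" for i d
  proof -
    define i' j j' where "i' = (i + 1) mod 9" and "j = (i + d) mod 9" and "j' = (i + d + 1) mod 9"
    have j': "j' = (j + 1) mod 9" by (simp add: j_def j'_def mod_simps)
    have lt: "i' < 9" "j < 9" "j' < 9" by (simp_all add: i'_def j_def j'_def)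
    have edge: "i \<noteq> i'" "\<not> kernel_adj i i'" "j \<noteq> j'" "\<not> kernel_adj j j'"
      using i lt by (auto simp: kernel_adj_def i'_def j' mod_Suc)
    have adj: "kernel_adj x y" "kernel_adj y x" if "x \<in> {i, i'}" "y \<in> {j, j'}" for x y
      using kernel_adj_far_edges[OF i d] that sympD[OF symp_kernel_adj]
      unfolding i'_def j_def j'_def by blast+
    have "same_side (q i) (q i') (q k) (q y)" if "y \<in> {j, j'}" for y
      by (rule same) (use i lt edge k adj that in auto)
    moreover have "same_side (q j) (q j') (q k) (q x)" if "x \<in> {i, i'}" for x
      by (rule same) (use i lt edge k adj that in auto)
    ultimately have "separated (t i) (t i') (t j) (t j')"
      unfolding t_def using i lt by (intro angularly_separated half) auto
    then show ?thesis by (simp only: i'_def j_def j'_def)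
  qed
  then show False by (rule no_separated_cycle)
qed

section \<open>Lexicographic powers\<close>

fun lex_adj :: "('a \<Rightarrow> 'a \<Rightarrow> bool) \<Rightarrow> 'a list \<Rightarrow> 'a list \<Rightarrow> bool" where
  "lex_adj adj (x # xs) (y # ys) = (if x = y then lex_adj adj xs ys else adj x y)"
| "lex_adj adj _ _ = False"

definition lex_power :: "'a set \<Rightarrow> nat \<Rightarrow> 'a list set" where
  "lex_power V n = {xs. set xs \<subseteq> V \<and> length xs = n}"

lemma symp_lex_adj:
  assumes "symp adj"
  shows "symp (lex_adj adj)"
proof (rule sympI)
  fix xs ys assume "lex_adj adj xs ys"
  with assms show "lex_adj adj ys xs"
  proof (induction adj xs ys rule: lex_adj.induct)
    case (1 adj x xs y ys)
    then show ?case
      using sympD[of adj x y] by (cases "x = y") simp_all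
  qed simp_all
qed

lemma finite_lex_power: "finite V \<Longrightarrow> finite (lex_power V n)"
  unfolding lex_power_def by (rule finite_lists_length_eq)

lemma lex_power_nonempty: "V \<noteq> {} \<Longrightarrow> lex_power V n \<noteq> {}"
  unfolding lex_power_def by (auto intro: exI[of _ "replicate n (SOME x. x \<in> V)"] simp: some_in_eq)

lemma Cons_in_lex_power [simp]: "x # xs \<in> lex_power V (Suc n) \<longleftrightarrow> x \<in> V \<and> xs \<in> lex_power V n"
  by (auto simp: lex_power_def)

lemma trap_hull_of_transversal:
  assumes "forces_trap V adj" and gen: "generic_on (lex_power V (Suc n)) p"
    and d: "\<And>x. x \<in> V \<Longrightarrow> d x \<in> lex_power V n"
  shows "\<exists>C \<in> trap_hulls (lex_power V (Suc n)) (lex_adj adj) p.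
    C \<subseteq> convex hull ((\<lambda>x. p (x # d x)) ` V)"
proof -
  have block: "(\<lambda>x. x # d x) ` V \<subseteq> lex_power V (Suc n)" using d by auto
  have "generic_on V (\<lambda>x. p (x # d x))"
    by (rule generic_on_reindex[OF gen _ block]) (simp add: inj_on_def)
  then obtain C where "C \<in> trap_hulls V adj (\<lambda>x. p (x # d x))"
    using assms(1) unfolding forces_trap_def by blast
  moreover have "trap_hulls V adj (\<lambda>x. p (x # d x)) \<subseteq>
      trap_hulls (lex_power V (Suc n)) (lex_adj adj) p"
    by (rule trap_hulls_reindex[OF block]) simp
  ultimately show ?thesis
    using trap_hulls_subset_hull[of C V adj "\<lambda>x. p (x # d x)"] by blast
qed

lemma exists_minimax_transversal:
  fixes f :: "'a \<Rightarrow> 'b \<Rightarrow> 'c::linorder"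
  assumes "finite V" "V \<noteq> {}" "finite W" "W \<noteq> {}"
  obtains d x where "x \<in> V" "\<And>y. y \<in> V \<Longrightarrow> d y \<in> W \<and> f y (d y) \<le> f x (d x)"
    "\<And>z. z \<in> W \<Longrightarrow> f x (d x) \<le> f x z"
proof -
  define d where "d y = arg_min_on (f y) W" for y
  have "d y \<in> W" "\<And>z. z \<in> W \<Longrightarrow> f y (d y) \<le> f y z" for y
    using assms(3,4) by (simp_all add: d_def arg_min_if_finite arg_min_least)
  moreover obtain x where "x \<in> V" "Max ((\<lambda>y. f y (d y)) ` V) = f x (d x)"
    using obtains_MAX[OF assms(1,2), of "\<lambda>y. f y (d y)"] .
  then have "f y (d y) \<le> f x (d x)" if "y \<in> V" for y
    using that assms(1) by (metis Max_ge finite_imageI imageI)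
  ultimately show thesis using \<open>x \<in> V\<close> that by blast
qed

lemma exists_block_right_of_line:
  assumes "3 \<le> card V" and gen: "generic_on (lex_power V (Suc n)) p"
    and right: "\<And>z. z \<in> lex_power V (Suc n) \<Longrightarrow> t \<le> p z $ 1"
  shows "\<exists>y\<in>V. \<forall>z\<in>lex_power V n. t < p (y # z) $ 1"
proof (rule ccontr)
  assume "\<not> ?thesis"
  then have "\<forall>y\<in>V. \<exists>z. z \<in> lex_power V n \<and> p (y # z) $ 1 \<le> t"
    by (metis not_le)
  then obtain d where d: "\<And>y. y \<in> V \<Longrightarrow> d y \<in> lex_power V n" "\<And>y. y \<in> V \<Longrightarrow> p (y # d y) $ 1 \<le> t"
    by metis
  then have on_line: "p (y # d y) $ 1 = t" if "y \<in> V" for y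
    using right[of "y # d y"] that by fastforce
  obtain y\<^sub>1 y\<^sub>2 y\<^sub>3 where y: "{y\<^sub>1, y\<^sub>2, y\<^sub>3} \<subseteq> V" "y\<^sub>1 \<noteq> y\<^sub>2" "y\<^sub>2 \<noteq> y\<^sub>3" "y\<^sub>1 \<noteq> y\<^sub>3"
    using obtain_subset_with_card_n[OF assms(1)] by (metis card_3_iff)
  then have "orient (p (y\<^sub>1 # d y\<^sub>1)) (p (y\<^sub>2 # d y\<^sub>2)) (p (y\<^sub>3 # d y\<^sub>3)) \<noteq> 0"
    using d(1) by (intro generic_on_orient[OF gen]) auto
  then show False using on_line y(1) by (simp add: orient_def)
qed

lemma convex_first_coord:
  "convex {w::real^2. w$1 \<le> t}" "convex {w::real^2. t < w$1}"
  using convex_halfspace_le[of "axis 1 1 :: real^2" t] convex_halfspace_gt[of t "axis 1 1 :: real^2"]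
  by (simp_all add: inner_axis')

text \<open>
  The leftmost points of the blocks form a transversal. The block whose leftmost point is furthest to
  the right lies weakly to the right of it, and as at most two points are on a vertical line, one
  of its sub-blocks lies strictly to the right.
\<close>

lemma trap_hull_left_of_block:
  assumes forces: "forces_trap V adj" and V: "finite V" "3 \<le> card V"
    and gen: "generic_on (lex_power V (Suc (Suc n))) p"
  obtains C t x y where "C \<in> trap_hulls (lex_power V (Suc (Suc n))) (lex_adj adj) p"
    "C \<subseteq> {w. w$1 \<le> t}" "x \<in> V" "y \<in> V" "\<And>z. z \<in> lex_power V n \<Longrightarrow> t < p (x # y # z) $ 1"
proof -
  have "V \<noteq> {}" using V by auto
  obtain d x where "x \<in> V"
    and d: "\<And>y. y \<in> V \<Longrightarrow> d y \<in> lex_power V (Suc n) \<and> p (y # d y) $ 1 \<le> p (x # d x) $ 1"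
    and right: "\<And>z. z \<in> lex_power V (Suc n) \<Longrightarrow> p (x # d x) $ 1 \<le> p (x # z) $ 1"
    using exists_minimax_transversal[OF V(1) \<open>V \<noteq> {}\<close>
        finite_lex_power[OF V(1)] lex_power_nonempty[OF \<open>V \<noteq> {}\<close>], where f = "\<lambda>y z. p (y # z) $ 1"] by metis
  define t where "t = p (x # d x) $ 1"
  obtain C where C: "C \<in> trap_hulls (lex_power V (Suc (Suc n))) (lex_adj adj) p"
    and C_hull: "C \<subseteq> convex hull ((\<lambda>y. p (y # d y)) ` V)"
    using trap_hull_of_transversal[OF forces gen] d by metis
  note C_hull
  also have "convex hull ((\<lambda>y. p (y # d y)) ` V) \<subseteq> {w. w$1 \<le> t}"
    by (intro hull_minimal convex_first_coord) (use d in \<open>auto simp: t_def\<close>)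
  finally have "C \<subseteq> {w. w$1 \<le> t}" .
  moreover have "generic_on (lex_power V (Suc n)) (\<lambda>z. p (x # z))"
    by (rule generic_on_reindex[OF gen]) (auto simp: inj_on_def \<open>x \<in> V\<close>)
  then obtain y where "y \<in> V" "\<And>z. z \<in> lex_power V n \<Longrightarrow> t < p (x # y # z) $ 1"
    using exists_block_right_of_line[OF V(2), of n "\<lambda>z. p (x # z)" t] right unfolding t_def by blast
  ultimately show thesis using that C \<open>x \<in> V\<close> by blast
qed

lemma disjoint_trap_hulls_lex_power:
  assumes forces: "forces_trap V adj" and V: "finite V" "3 \<le> card V"
    and "generic_on (lex_power V (2 * h)) p"
  shows "\<exists>\<C> \<subseteq> trap_hulls (lex_power V (2 * h)) (lex_adj adj) p.
    finite \<C> \<and> card \<C> = h \<and> pairwise disjnt \<C>"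
  using assms(4)
proof (induction h arbitrary: p)
  case 0
  show ?case by (rule exI[of _ "{}"]) simp
next
  case (Suc h)
  let ?L = "lex_power V (2 * h)" and ?M = "lex_power V (Suc (Suc (2 * h)))"
  have gen: "generic_on ?M p" using Suc.prems by simp
  obtain D t x y where D: "D \<in> trap_hulls ?M (lex_adj adj) p" "D \<subseteq> {w. w$1 \<le> t}"
    and xy: "x \<in> V" "y \<in> V" and right: "\<And>z. z \<in> ?L \<Longrightarrow> t < p (x # y # z) $ 1"
    using trap_hull_left_of_block[OF forces V gen] by metis
  define q where "q z = p (x # y # z)" for z
  have block: "(\<lambda>z. x # y # z) ` ?L \<subseteq> ?M" using xy by auto
  have "generic_on ?L q" unfolding q_def
    by (rule generic_on_reindex[OF gen _ block]) (simp add: inj_on_def)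
  from Suc.IH[OF this] obtain \<C> where \<C>: "\<C> \<subseteq> trap_hulls ?L (lex_adj adj) q"
    and fin: "finite \<C>" "card \<C> = h" and disj: "pairwise disjnt \<C>" by blast
  have "convex hull (q ` ?L) \<subseteq> {w. t < w$1}"
    by (intro hull_minimal convex_first_coord) (use right in \<open>auto simp: q_def\<close>)
  then have "C \<subseteq> {w. t < w$1}" if "C \<in> \<C>" for C
    using trap_hulls_subset_hull[of C] \<C> that by blast
  then have D_disj: "disjnt D C" "disjnt C D" if "C \<in> \<C>" for C
    using D(2) that by (force simp: disjnt_iff)+
  have "D \<notin> \<C>"
    using D_disj(1)[of D] trap_hulls_nonempty[OF D(1)] by (auto simp: disjnt_def)
  have "trap_hulls ?L (lex_adj adj) q \<subseteq> trap_hulls ?M (lex_adj adj) p"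
    unfolding q_def by (rule trap_hulls_reindex[OF block]) simp
  then have "insert D \<C> \<subseteq> trap_hulls ?M (lex_adj adj) p" using D(1) \<C> by blast
  moreover have "card (insert D \<C>) = Suc h" using fin \<open>D \<notin> \<C>\<close> by simp
  moreover have "pairwise disjnt (insert D \<C>)" using disj D_disj by (simp add: pairwise_insert)
  ultimately show ?case using fin(1) by (intro exI[of _ "insert D \<C>"]) simp
qed

section \<open>The lower bound\<close>

lemma obstacle_in_trap_hull:
  assumes rep: "obstacle_representation G p \<O>"
    and C: "C \<in> trap_hulls (pverts G) (\<lambda>x y. (x, y) \<in> parcs G) p"
  shows "\<exists>S\<in>\<O>. S \<noteq> {} \<and> S \<subseteq> C"
proof -
  obtain u v a b where uvab: "{u, v, a, b} \<subseteq> pverts G"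
    and tr: "trapped (\<lambda>x y. (x, y) \<in> parcs G) p u v a b"
    and C_def: "C = convex hull {p u, p v, p a, p b}"
    using C unfolding trap_hulls_def by blast
  have visible: "(x, y) \<in> parcs G \<longleftrightarrow> (\<forall>S\<in>\<O>. closed_segment (p x) (p y) \<inter> S = {})"
    if "x \<in> pverts G" "y \<in> pverts G" "x \<noteq> y" for x y
    using rep that unfolding obstacle_representation_def by blast
  have ne: "u \<noteq> v" "u \<noteq> a" "v \<noteq> a" "u \<noteq> b" "v \<noteq> b"
    using trapped_distinct[OF tr] by auto
  then obtain S where S: "S \<in> \<O>" "closed_segment (p u) (p v) \<inter> S \<noteq> {}"
    using visible[of u v] uvab tr by (auto simp: trapped_def)
  have "connected S" using rep S(1) by (auto simp: obstacle_representation_def polygonal_obstacle_def)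
  then have "S \<subseteq> C"
    unfolding C_def using tr S visible uvab ne
    by (intro connected_subset_quadrilateral) (simp_all add: trapped_def)
  then show ?thesis using S by blast
qed

lemma card_le_if_disjoint_supersets:
  assumes "finite \<O>" "pairwise disjnt \<C>" and sub: "\<And>C. C \<in> \<C> \<Longrightarrow> \<exists>S\<in>\<O>. S \<noteq> {} \<and> S \<subseteq> C"
  shows "card \<C> \<le> card \<O>"
proof -
  obtain g where g: "\<And>C. C \<in> \<C> \<Longrightarrow> g C \<in> \<O> \<and> g C \<noteq> {} \<and> g C \<subseteq> C"
    using sub by metis
  have "inj_on g \<C>"
  proof (rule inj_onI, rule ccontr)
    fix C D assume "C \<in> \<C>" "D \<in> \<C>" "g C = g D" "C \<noteq> D"
    moreover from this have "C \<inter> D = {}" using assms(2) by (auto simp: pairwise_def disjnt_def)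
    ultimately show False using g[of C] g[of D] by blast
  qed
  moreover have "g ` \<C> \<subseteq> \<O>" using g by blast
  ultimately show ?thesis using assms(1) card_inj_on_le by blast
qed

lemma obs_ge_if_induced_lex_power:
  assumes forces: "forces_trap V adj" and V: "finite V" "3 \<le> card V"
    and e: "inj_on e (lex_power V (2 * h))" "e ` lex_power V (2 * h) \<subseteq> pverts G"
    and adj: "\<And>x y. \<lbrakk>x \<in> lex_power V (2 * h); y \<in> lex_power V (2 * h); x \<noteq> y\<rbrakk>
      \<Longrightarrow> (e x, e y) \<in> parcs G \<longleftrightarrow> lex_adj adj x y"
  shows "enat h \<le> obs G"
  unfolding obs_def
proof (rule INF_greatest)
  fix \<O> assume "\<O> \<in> {\<O>. \<exists>p. obstacle_representation G p \<O>}"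
  then obtain p where rep: "obstacle_representation G p \<O>" by blast
  then have "generic_on (pverts G) p"
    by (auto simp: obstacle_representation_def generic_on_def elim: general_position_mono)
  then have "generic_on (lex_power V (2 * h)) (\<lambda>x. p (e x))"
    using e by (rule generic_on_reindex)
  from disjoint_trap_hulls_lex_power[OF forces V this] obtain \<C>
    where \<C>: "\<C> \<subseteq> trap_hulls (lex_power V (2 * h)) (lex_adj adj) (\<lambda>x. p (e x))"
      and "card \<C> = h" and disj: "pairwise disjnt \<C>" by blast
  note \<C>
  also have "trap_hulls (lex_power V (2 * h)) (lex_adj adj) (\<lambda>x. p (e x)) \<subseteq>
      trap_hulls (pverts G) (\<lambda>x y. (x, y) \<in> parcs G) p"
    by (intro trap_hulls_reindex e(2)) (simp add: adj)
  finally have "\<And>C. C \<in> \<C> \<Longrightarrow> \<exists>S\<in>\<O>. S \<noteq> {} \<and> S \<subseteq> C"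
    using obstacle_in_trap_hull[OF rep] by blast
  moreover have "finite \<O>" using rep by (simp add: obstacle_representation_def)
  ultimately have "card \<C> \<le> card \<O>"
    using disj by (intro card_le_if_disjoint_supersets)
  then show "enat h \<le> enat (card \<O>)" by (simp add: \<open>card \<C> = h\<close>)
qed

section \<open>Vertices of polygonal regions\<close>

lemma affine_hull_2_eq:
  fixes a :: "'a::euclidean_space"
  assumes "x \<noteq> y" "{x, y} \<subseteq> affine hull {a, b}"
  shows "affine hull {x, y} = affine hull {a, b}"
proof -
  have sub: "affine hull {x, y} \<subseteq> affine hull {a, b}"
    using assms(2) by (intro hull_minimal affine_affine_hull)
  then have "aff_dim {x, y} \<le> aff_dim {a, b}"
    by (metis aff_dim_affine_hull aff_dim_subset)
  then have "aff_dim {x, y} = aff_dim {a, b}" using assms(1) by (simp split: if_splits)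
  with sub show ?thesis by (intro affine_dim_equal) simp_all
qed

lemma affine_hull_2_Int_subset_singleton:
  fixes a :: "'a::euclidean_space"
  assumes "affine hull {a, b} \<noteq> affine hull {c, d}"
  shows "\<exists>x. affine hull {a, b} \<inter> affine hull {c, d} \<subseteq> {x}"
proof -
  have "x = y"
    if "x \<in> affine hull {a, b} \<inter> affine hull {c, d}" "y \<in> affine hull {a, b} \<inter> affine hull {c, d}" for x y
    using affine_hull_2_eq[of x y a b] affine_hull_2_eq[of x y c d] that assms by auto
  then show ?thesis by blast
qed

lemma orient_proportional:
  assumes "{c, d} \<subseteq> affine hull {a, b}"
  obtains k where "\<And>x. orient c d x = k * orient a b x"
proof -
  obtain s t where c: "c = a + s *\<^sub>R (b - a)" and d: "d = a + t *\<^sub>R (b - a)"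
    using assms unfolding affine_hull_2_alt by blast
  have "orient c d x = (t - s) * orient a b x" for x
    unfolding c d by (simp add: orient_def algebra_simps)
  then show thesis by (rule that)
qed

lemma open_crosses_hyperplane:
  fixes a :: "'a::real_inner"
  assumes "open W" "x \<in> W" "a \<bullet> x = b" "a \<noteq> 0"
  obtains y z where "y \<in> W" "a \<bullet> y < b" "z \<in> W" "a \<bullet> z > b"
proof -
  obtain d where d: "d > 0" "ball x d \<subseteq> W"
    using assms(1,2) open_contains_ball by blast
  define s where "s = d / (2 * norm a)"
  have "s > 0" "norm (s *\<^sub>R a) < d" using d(1) \<open>a \<noteq> 0\<close> by (simp_all add: s_def)
  then have "x - s *\<^sub>R a \<in> W" "x + s *\<^sub>R a \<in> W"
    using d(2) by (auto simp: subset_iff dist_norm)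
  moreover have "a \<bullet> (x - s *\<^sub>R a) < b" "a \<bullet> (x + s *\<^sub>R a) > b"
    using assms(3) \<open>s > 0\<close> \<open>a \<noteq> 0\<close> by (simp_all add: inner_add_right inner_diff_right)
  ultimately show thesis using that by blast
qed

lemma frontier_Int_eq_hyperplane_Int:
  fixes a v :: "'a::real_inner"
  assumes "a \<noteq> 0" "a \<bullet> v = b" and U: "open U" "v \<in> U" and S: "closed S" "v \<in> frontier S"
    and det: "\<And>x y. \<lbrakk>x \<in> U; y \<in> U; sgn (a \<bullet> x - b) = sgn (a \<bullet> y - b); x \<in> S\<rbrakk> \<Longrightarrow> y \<in> S"
  shows "frontier S \<inter> U = {x. a \<bullet> x = b} \<inter> U"
proof (intro set_eqI iffI)
  fix x assume x: "x \<in> frontier S \<inter> U"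
  then have "x \<in> S" "x \<notin> interior S" using S(1) by (auto simp: frontier_def)
  define W where "W = U \<inter> (if a \<bullet> x < b then {y. a \<bullet> y < b} else {y. a \<bullet> y > b})"
  have "open W" using U(1) by (simp add: W_def open_Int open_halfspace_lt open_halfspace_gt)
  moreover have "W \<subseteq> S" if "a \<bullet> x \<noteq> b"
    using det[of x] x \<open>x \<in> S\<close> that by (auto simp: W_def split: if_splits)
  ultimately have "a \<bullet> x \<noteq> b \<Longrightarrow> x \<notin> W"
    using \<open>x \<notin> interior S\<close> by (meson interior_maximal subsetD)
  then show "x \<in> {x. a \<bullet> x = b} \<inter> U"
    using x by (cases "a \<bullet> x" b rule: linorder_cases) (auto simp: W_def)
next
  fix x assume x: "x \<in> {x. a \<bullet> x = b} \<inter> U"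
  have "v \<in> S" "v \<notin> interior S" using S by (auto simp: frontier_def)
  have "x \<in> S" using det[of v x] x \<open>v \<in> S\<close> U(2) assms(2) by simp
  moreover have "x \<notin> interior S"
  proof
    assume "x \<in> interior S"
    then have "open (interior S \<inter> U)" "x \<in> interior S \<inter> U" "a \<bullet> x = b" using x U(1) by auto
    from open_crosses_hyperplane[OF this \<open>a \<noteq> 0\<close>] obtain y z
      where y: "y \<in> interior S \<inter> U" "a \<bullet> y < b" and z: "z \<in> interior S \<inter> U" "a \<bullet> z > b" .
    have "y \<in> S" "z \<in> S" using y z interior_subset by blast+
    then have "U \<subseteq> S"
    proof (intro subsetI)
      fix w assume "w \<in> U"
      then show "w \<in> S"
        using det[of v w] det[of y w] det[of z w] y z \<open>y \<in> S\<close> \<open>z \<in> S\<close> \<open>v \<in> S\<close> U(2) assms(2)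
        by (cases "a \<bullet> w" b rule: linorder_cases) auto
    qed
    then show False using U \<open>v \<notin> interior S\<close> by (meson interior_maximal subsetD)
  qed
  ultimately show "x \<in> frontier S \<inter> U" using x S(1) by (simp add: frontier_def)
qed

text \<open>
  A pair \<open>(a, b)\<close> stands for the line from \<open>a\<close> to \<open>b\<close>, and the points on this line count as being
  to its left.
\<close>

definition union_of_cells :: "((real^2) \<times> (real^2)) set \<Rightarrow> (real^2) set \<Rightarrow> bool" where
  "union_of_cells L S \<longleftrightarrow>
     (\<forall>x\<in>S. \<forall>y. (\<forall>(a, b)\<in>L. 0 \<le> orient a b x \<longleftrightarrow> 0 \<le> orient a b y) \<longrightarrow> y \<in> S)"

lemma union_of_cells_Union:
  assumes "\<And>T. T \<in> \<T> \<Longrightarrow> union_of_cells (L T) T"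
  shows "union_of_cells (\<Union>(L ` \<T>)) (\<Union>\<T>)"
  unfolding union_of_cells_def
proof (intro ballI allI impI)
  fix x y assume "x \<in> \<Union>\<T>"
    and same: "\<forall>(a, b)\<in>\<Union>(L ` \<T>). 0 \<le> orient a b x \<longleftrightarrow> 0 \<le> orient a b y"
  then obtain T where T: "T \<in> \<T>" "x \<in> T" by blast
  have "\<forall>(a, b)\<in>L T. 0 \<le> orient a b x \<longleftrightarrow> 0 \<le> orient a b y" using same T(1) by blast
  then show "y \<in> \<Union>\<T>" using assms[OF T(1)] T unfolding union_of_cells_def by blast
qed

lemma union_of_cells_triangle:
  "orient x y z > 0 \<Longrightarrow> union_of_cells {(x, y), (y, z), (z, x)} (convex hull {x, y, z})"
  by (simp add: union_of_cells_def mem_triangle_iff_orient)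

lemma eventually_same_sign_orient:
  assumes "finite L"
  shows "\<forall>\<^sub>F x in nhds v. \<forall>(a, b)\<in>L. orient a b v \<noteq> 0 \<longrightarrow> (0 \<le> orient a b x \<longleftrightarrow> 0 \<le> orient a b v)"
proof -
  have "\<forall>\<^sub>F x in nhds v. 0 \<le> orient a b x \<longleftrightarrow> 0 \<le> orient a b v" if "orient a b v \<noteq> 0" for a b
  proof -
    have "open {x. (0 < orient a b v * orient a b x)}"
      by (intro open_Collect_less continuous_intros)
    then have "\<forall>\<^sub>F x in nhds v. x \<in> {x. (0 < orient a b v * orient a b x)}"
      using that by (intro eventually_nhds_in_open) (auto simp: zero_less_mult_iff neq_iff)
    then show ?thesis by (rule eventually_mono) (auto simp: zero_less_mult_iff)
  qed
  then show ?thesis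
    by (intro eventually_ball_finite assms) (auto simp: eventually_conj_iff split: prod.split)
qed

lemma frontier_union_of_cells_on_line:
  assumes "finite L" "union_of_cells L S" "v \<in> frontier S"
  shows "\<exists>(a, b)\<in>L. orient a b v = 0"
proof (rule ccontr)
  assume "\<not> ?thesis"
  then have "\<forall>\<^sub>F x in nhds v. \<forall>(a, b)\<in>L. 0 \<le> orient a b x \<longleftrightarrow> 0 \<le> orient a b v"
    by (intro eventually_mono[OF eventually_same_sign_orient[OF assms(1)]]) blast
  then obtain U where U: "open U" "v \<in> U"
    and same: "\<And>x. x \<in> U \<Longrightarrow> \<forall>(a, b)\<in>L. 0 \<le> orient a b x \<longleftrightarrow> 0 \<le> orient a b v"
    unfolding eventually_nhds by blast
  have "y \<in> S" if "x \<in> U" "y \<in> U" "x \<in> S" for x y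
  proof -
    have "\<forall>(a, b)\<in>L. 0 \<le> orient a b x \<longleftrightarrow> 0 \<le> orient a b y"
      using same[OF that(1)] same[OF that(2)] by blast
    then show ?thesis using assms(2) \<open>x \<in> S\<close> unfolding union_of_cells_def by blast
  qed
  then have "U \<subseteq> S \<or> U \<inter> S = {}" by blast
  moreover have "v \<in> closure S" "v \<notin> interior S" using assms(3) by (auto simp: frontier_def)
  then have "U \<inter> S \<noteq> {}" "\<not> U \<subseteq> S"
    using open_Int_closure_eq_empty[OF U(1), of S] interior_maximal[OF _ U(1), of S] U(2) by blast+
  ultimately show False by blast
qed

lemma union_of_cells_near_single_line:
  assumes L: "finite L" and S: "union_of_cells L S"
    and single: "\<And>c d. \<lbrakk>(c, d) \<in> L; orient c d v = 0\<rbrakk> \<Longrightarrow> {c, d} \<subseteq> affine hull {a, b}"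
  obtains e where "e > 0"
    "\<And>x y. \<lbrakk>x \<in> ball v e; y \<in> ball v e; sgn (orient a b x) = sgn (orient a b y); x \<in> S\<rbrakk> \<Longrightarrow> y \<in> S"
proof -
  obtain e where "e > 0"
    and near: "\<And>x. dist x v < e \<Longrightarrow>
      \<forall>(c, d)\<in>L. orient c d v \<noteq> 0 \<longrightarrow> (0 \<le> orient c d x \<longleftrightarrow> 0 \<le> orient c d v)"
    using eventually_same_sign_orient[OF L, of v] unfolding eventually_nhds_metric by blast
  have "0 \<le> orient c d x \<longleftrightarrow> 0 \<le> orient c d y"
    if cd: "(c, d) \<in> L" and xy: "x \<in> ball v e" "y \<in> ball v e"
      and sgn: "sgn (orient a b x) = sgn (orient a b y)"
    for c d x y
  proof (cases "orient c d v = 0")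
    case True
    then obtain k where k: "\<And>x. orient c d x = k * orient a b x"
      using orient_proportional[OF single[OF cd True]] by blast
    have "0 \<le> orient c d z \<longleftrightarrow> 0 \<le> sgn k * sgn (orient a b z)" for z
      unfolding k sgn_mult[symmetric] by simp
    then show ?thesis using sgn by simp
  next
    case False
    then show ?thesis using near[of x] near[of y] cd xy by (auto simp: dist_commute)
  qed
  then have "y \<in> S"
    if "x \<in> ball v e" "y \<in> ball v e" "sgn (orient a b x) = sgn (orient a b y)" "x \<in> S" for x y
    using S that unfolding union_of_cells_def by blast
  with \<open>e > 0\<close> show thesis using that by blast
qed

lemma region_vertex_on_two_lines:
  assumes L: "finite L" "\<And>a b. (a, b) \<in> L \<Longrightarrow> a \<noteq> b" and S: "closed S" "union_of_cells L S"
    and v: "v \<in> region_vertices S"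
  shows "\<exists>(a, b)\<in>L. \<exists>(c, d)\<in>L. affine hull {a, b} \<noteq> affine hull {c, d} \<and>
    v \<in> affine hull {a, b} \<inter> affine hull {c, d}"
proof (rule ccontr)
  assume one_line: "\<not> ?thesis"
  have vS: "v \<in> frontier S" using v by (simp add: region_vertices_def)
  obtain a b where ab: "(a, b) \<in> L" "orient a b v = 0"
    using frontier_union_of_cells_on_line[OF L(1) S(2) vS] by blast
  then have "a \<noteq> b" and v_ab: "v \<in> affine hull {a, b}"
    using L(2) by (auto simp: affine_hull_2_eq_orient)
  have "affine hull {a, b} = affine hull {c, d}" if "(c, d) \<in> L" "orient c d v = 0" for c d
    using one_line ab(1) v_ab that L(2)[OF that(1)] by (fastforce simp: affine_hull_2_eq_orient)
  then have "{c, d} \<subseteq> affine hull {a, b}" if "(c, d) \<in> L" "orient c d v = 0" for c d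
    using that hull_subset[of "{c, d}" affine] by metis
  then obtain e where "e > 0" and det:
    "\<And>x y. \<lbrakk>x \<in> ball v e; y \<in> ball v e; sgn (orient a b x) = sgn (orient a b y); x \<in> S\<rbrakk> \<Longrightarrow> y \<in> S"
    using union_of_cells_near_single_line[OF L(1) S(2), of v a b] by blast
  have "frontier S \<inter> ball v e = {x. left_normal a b \<bullet> x = left_normal a b \<bullet> a} \<inter> ball v e"
  proof (rule frontier_Int_eq_hyperplane_Int)
    show "left_normal a b \<bullet> v = left_normal a b \<bullet> a"
      using ab(2) orient_eq_0_hyperplane[of a b] by blast
    show "y \<in> S" if "x \<in> ball v e" "y \<in> ball v e" "x \<in> S"
      and "sgn (left_normal a b \<bullet> x - left_normal a b \<bullet> a) =
        sgn (left_normal a b \<bullet> y - left_normal a b \<bullet> a)" for x y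
      using that by (intro det[of x y]) (simp_all add: orient_eq_inner inner_diff_right)
  qed (use \<open>a \<noteq> b\<close> \<open>e > 0\<close> S(1) vS in auto)
  then have "frontier S \<inter> ball v e = affine hull {a, b} \<inter> ball v e"
    by (simp only: affine_hull_2_eq_orient[OF \<open>a \<noteq> b\<close>] orient_eq_0_hyperplane)
  moreover obtain w where "w \<noteq> v" "w \<in> {a, b}" using \<open>a \<noteq> b\<close> by (metis insertCI)
  moreover from this have "affine hull {v, w} = affine hull {a, b}"
    using v_ab by (intro affine_hull_2_eq) (auto simp: hull_inc)
  ultimately have "frontier S \<inter> ball v e = affine hull {v, w} \<inter> ball v e" by simp
  then show False using v \<open>e > 0\<close> \<open>w \<noteq> v\<close> unfolding region_vertices_def by blast
qed

lemma finite_region_vertices_if_union_of_cells: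
  assumes L: "finite L" "\<And>a b. (a, b) \<in> L \<Longrightarrow> a \<noteq> b" and S: "closed S" "union_of_cells L S"
  shows "finite (region_vertices S)"
proof -
  define P where "P = {((a, b), (c, d)). (a, b) \<in> L \<and> (c, d) \<in> L \<and>
    affine hull {a, b} \<noteq> affine hull {c, d}}"
  have "finite P" by (rule finite_subset[of _ "L \<times> L"]) (auto simp: P_def L(1))
  moreover have "finite (affine hull {a, b} \<inter> affine hull {c, d})"
    if "((a, b), (c, d)) \<in> P" for a b c d
  proof -
    have "affine hull {a, b} \<noteq> affine hull {c, d}" using that by (simp add: P_def)
    from affine_hull_2_Int_subset_singleton[OF this] show ?thesis using finite_subset by blast
  qed
  ultimately have "finite (\<Union>((a, b), (c, d))\<in>P. affine hull {a, b} \<inter> affine hull {c, d})"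
    by auto
  moreover have "region_vertices S \<subseteq> (\<Union>((a, b), (c, d))\<in>P. affine hull {a, b} \<inter> affine hull {c, d})"
    using region_vertex_on_two_lines[OF L S] by (fastforce simp: P_def)
  ultimately show ?thesis by (rule rev_finite_subset)
qed

lemma region_vertices_triangle:
  assumes pos: "orient x y z > 0"
  shows "region_vertices (convex hull {x, y, z}) \<subseteq> {x, y, z}"
proof
  let ?L = "{(x, y), (y, z), (z, x)}"
  fix v assume v: "v \<in> region_vertices (convex hull {x, y, z})"
  have ne: "x \<noteq> y" "y \<noteq> z" "z \<noteq> x" using pos by auto
  have "closed (convex hull {x, y, z})"
    by (simp add: compact_imp_closed finite_imp_compact_convex_hull)
  then have "\<exists>(a, b)\<in>?L. \<exists>(c, d)\<in>?L. affine hull {a, b} \<noteq> affine hull {c, d} \<and>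
      v \<in> affine hull {a, b} \<inter> affine hull {c, d}"
    by (intro region_vertex_on_two_lines[OF _ _ _ union_of_cells_triangle[OF pos] v]) (use ne in auto)
  then have "orient x y v = 0 \<and> orient y z v = 0 \<or> orient y z v = 0 \<and> orient z x v = 0 \<or>
      orient x y v = 0 \<and> orient z x v = 0"
    by (auto simp: affine_hull_2_eq_orient ne)
  then show "v \<in> {x, y, z}"
    using orient_barycentric[of x y z v] orient_barycentric_sum[of y z v x] pos by auto
qed

lemma simplex_2_iff: "2 simplex T \<longleftrightarrow> (\<exists>x y z. orient x y z > 0 \<and> T = convex hull {x, y, z})"
proof
  assume "2 simplex T"
  then obtain C where C: "\<not> affine_dependent C" "card C = 3" "T = convex hull C"
    unfolding simplex_def by auto
  obtain x y z where xyz: "C = {x, y, z}" "x \<noteq> y" "y \<noteq> z" "x \<noteq> z"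
    using C(2) unfolding card_3_iff by blast
  then have "orient x y z \<noteq> 0"
    using C(1) collinear_3_eq_affine_dependent[of x y z] by (simp add: collinear_iff_orient)
  then consider "orient x y z > 0" | "orient y x z > 0"
    using orient_swap[of y x z] by (cases "orient x y z > 0") auto
  then show "\<exists>x y z. orient x y z > 0 \<and> T = convex hull {x, y, z}"
  proof cases
    case 1
    then show ?thesis using C(3) xyz(1) by blast
  next
    case 2
    moreover have "T = convex hull {y, x, z}" using C(3) xyz(1) by (simp add: insert_commute)
    ultimately show ?thesis by blast
  qed
next
  assume "\<exists>x y z. orient x y z > 0 \<and> T = convex hull {x, y, z}"
  then obtain x y z where pos: "orient x y z > 0" and T: "T = convex hull {x, y, z}" by blast
  then have "\<not> affine_dependent {x, y, z}"
    using collinear_3_eq_affine_dependent[of x y z] by (auto simp: collinear_iff_orient)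
  moreover have "x \<noteq> y" "y \<noteq> z" "x \<noteq> z" using pos by auto
  ultimately show "2 simplex T" unfolding T by (intro simplex_convex_hull) simp
qed

lemma polygonal_obstacle_triangle:
  assumes "orient x y z > 0"
  shows "polygonal_obstacle (convex hull {x, y, z})"
proof -
  have "2 simplex (convex hull {x, y, z})" using assms simplex_2_iff by blast
  then have "polygonal_region (convex hull {x, y, z})"
    unfolding polygonal_region_def by (intro exI[of _ "{convex hull {x, y, z}}"]) simp
  then show ?thesis by (simp add: polygonal_obstacle_def convex_connected)
qed

lemma finite_region_vertices:
  assumes "polygonal_region S"
  shows "finite (region_vertices S)"
proof -
  obtain \<T> where \<T>: "finite \<T>" "\<forall>T\<in>\<T>. 2 simplex T" and S: "S = \<Union>\<T>"
    using assms unfolding polygonal_region_def by blast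
  have "\<exists>L. finite L \<and> (\<forall>(a, b)\<in>L. a \<noteq> b) \<and> union_of_cells L T" if T: "T \<in> \<T>" for T
  proof -
    obtain x y z where "orient x y z > 0" "T = convex hull {x, y, z}"
      using bspec[OF \<T>(2) T] unfolding simplex_2_iff by blast
    then show ?thesis
      using union_of_cells_triangle by (intro exI[of _ "{(x, y), (y, z), (z, x)}"]) auto
  qed
  then obtain L where L: "\<And>T. T \<in> \<T> \<Longrightarrow> finite (L T) \<and> (\<forall>(a, b)\<in>L T. a \<noteq> b) \<and> union_of_cells (L T) T"
    by metis
  have "closed S"
    unfolding S using \<T> by (intro closed_Union) (auto intro: compact_imp_closed compact_simplex)
  moreover have "union_of_cells (\<Union>(L ` \<T>)) S"
    unfolding S by (rule union_of_cells_Union) (use L in blast)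
  moreover have "finite (\<Union>(L ` \<T>))" using \<T>(1) L by blast
  ultimately show ?thesis
    using L by (intro finite_region_vertices_if_union_of_cells[of "\<Union>(L ` \<T>)"]) auto
qed

section \<open>Deleting an edge\<close>

lemma general_position_insert:
  assumes gp: "general_position X" and x: "\<And>y z. \<lbrakk>y \<in> X; z \<in> X; y \<noteq> z\<rbrakk> \<Longrightarrow> orient y z x \<noteq> 0"
  shows "general_position (insert x X)"
  unfolding general_position_def collinear_iff_orient
proof (intro ballI impI)
  fix a b c
  assume "a \<in> insert x X" "b \<in> insert x X" "c \<in> insert x X" "a \<noteq> b \<and> b \<noteq> c \<and> a \<noteq> c"
  then show "orient a b c \<noteq> 0"
    using general_position_orient[OF gp, of a b c] x[of b c] x[of c a] x[of a b]
      orient_rotate[of b c a] orient_rotate[of c a b] by auto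
qed

lemma exists_generic_point:
  assumes fin: "finite X" and gp: "general_position X" and U: "open U" "U \<noteq> {}"
  obtains x where "x \<in> U" "general_position (insert x X)"
proof -
  define P where "P = {(y, z). y \<in> X \<and> z \<in> X \<and> y \<noteq> z}"
  have "finite P" by (rule finite_subset[of _ "X \<times> X"]) (auto simp: P_def fin)
  moreover have "negligible {x. orient y z x = 0}" if "y \<noteq> z" for y z
    using that unfolding orient_eq_0_hyperplane by (intro negligible_hyperplane) simp
  ultimately have "negligible (\<Union>(y, z)\<in>P. {x. orient y z x = 0})"
    by (intro negligible_Union) (auto simp: P_def)
  then obtain x where "x \<in> U" and x: "x \<notin> (\<Union>(y, z)\<in>P. {x. orient y z x = 0})"
    using open_not_negligible[OF U] negligible_subset by blast
  have "orient y z x \<noteq> 0" if "y \<in> X" "z \<in> X" "y \<noteq> z" for y z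
    using x that by (auto simp: P_def)
  then show thesis using that \<open>x \<in> U\<close> general_position_insert[OF gp] by blast
qed

lemma exists_generic_triangle_around:
  assumes fin: "finite X" and gp: "general_position X" and "r > 0"
  obtains x y z where "{x, y, z} \<subseteq> ball m r" "general_position (X \<union> {x, y, z})"
    "orient x y z > 0" "m \<in> convex hull {x, y, z}"
proof -
  have "ball m r \<noteq> {m}" by (metis not_open_singleton open_ball)
  then have "ball m r - {m} \<noteq> {}" using \<open>r > 0\<close> by auto
  then obtain x where x: "x \<in> ball m r - {m}" and gx: "general_position (insert x X)"
    using exists_generic_point[OF fin gp, of "ball m r - {m}"] by auto
  define U where "U = ball m r \<inter> {y. orient m x y > 0}"
  have "m + left_normal m x \<in> U"
    using x by (auto simp: U_def dist_norm norm_left_normal orient_eq_inner)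
  moreover have "open U"
    unfolding U_def by (intro open_Int open_ball open_Collect_less continuous_intros)
  ultimately obtain y where y: "y \<in> U" and gy: "general_position (insert y (insert x X))"
    using exists_generic_point[OF _ gx, of U] fin by auto
  define W where "W = ball m r \<inter> {z. orient m y z > 0} \<inter> {z. orient x m z > 0}"
  define z\<^sub>0 where "z\<^sub>0 = m - (1 / 2) *\<^sub>R ((x - m) + (y - m))"
  have "norm ((x - m) + (y - m)) \<le> dist m x + dist m y"
    using norm_triangle_ineq[of "x - m" "y - m"] by (simp add: dist_norm norm_minus_commute)
  then have "z\<^sub>0 \<in> ball m r"
    using x y by (simp add: z\<^sub>0_def U_def dist_norm)
  moreover have "orient m y z\<^sub>0 = orient m x y / 2" "orient x m z\<^sub>0 = orient m x y / 2"
    by (simp_all add: z\<^sub>0_def orient_def field_simps)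
  ultimately have "z\<^sub>0 \<in> W" using y by (simp add: W_def U_def)
  moreover have "open W"
    unfolding W_def by (intro open_Int open_ball open_Collect_less continuous_intros)
  ultimately obtain z where z: "z \<in> W" and gz: "general_position (insert z (insert y (insert x X)))"
    using exists_generic_point[OF _ gy, of W] fin by auto
  have "orient y z m > 0" "orient z x m > 0" "orient x y m > 0"
    using y z orient_rotate[of y z m] orient_rotate[of x m z] orient_rotate[of x y m]
    by (simp_all add: U_def W_def)
  moreover from this have "orient x y z > 0"
    using orient_barycentric_sum[of y z m x] by linarith
  ultimately have "m \<in> convex hull {x, y, z}"
    by (simp add: mem_triangle_iff_orient)
  moreover have "{x, y, z} \<subseteq> ball m r" using x y z by (simp add: U_def W_def)
  moreover have "general_position (X \<union> {x, y, z})" using gz by (simp add: insert_commute)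
  ultimately show thesis using that \<open>orient x y z > 0\<close> by blast
qed

lemma exists_ball_off_segments:
  assumes "finite E" "u \<noteq> v" and off: "\<And>a b. (a, b) \<in> E \<Longrightarrow> orient u v a \<noteq> 0 \<or> orient u v b \<noteq> 0"
  obtains m r where "m \<in> open_segment u v" "r > 0"
    "\<And>a b. (a, b) \<in> E \<Longrightarrow> closed_segment a b \<inter> ball m r = {}"
proof -
  have "finite (affine hull {u, v} \<inter> affine hull {a, b})" if "(a, b) \<in> E" for a b
  proof -
    have "affine hull {u, v} \<noteq> affine hull {a, b}"
      using off[OF that] hull_inc[of a "{a, b}"] hull_inc[of b "{a, b}"]
      by (auto simp: affine_hull_2_eq_orient[OF \<open>u \<noteq> v\<close>])
    from affine_hull_2_Int_subset_singleton[OF this] show ?thesis using finite_subset by blast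
  qed
  then have "finite (\<Union>(a, b)\<in>E. affine hull {u, v} \<inter> affine hull {a, b})"
    using \<open>finite E\<close> by auto
  moreover have "infinite (open_segment u v)" using \<open>u \<noteq> v\<close> by simp
  ultimately have "\<not> open_segment u v \<subseteq> (\<Union>(a, b)\<in>E. affine hull {u, v} \<inter> affine hull {a, b})"
    using finite_subset by blast
  then obtain m where m: "m \<in> open_segment u v"
    "m \<notin> (\<Union>(a, b)\<in>E. affine hull {u, v} \<inter> affine hull {a, b})" by blast
  have "m \<in> affine hull {u, v}"
    using m(1) segment_open_subset_closed convex_hull_subset_affine_hull
    unfolding segment_convex_hull by blast
  then have "m \<notin> closed_segment a b" if "(a, b) \<in> E" for a b
    using m(2) that convex_hull_subset_affine_hull[of "{a, b}"]
    unfolding segment_convex_hull by blast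
  then have "m \<in> - (\<Union>(a, b)\<in>E. closed_segment a b)" by blast
  moreover have "open (- (\<Union>(a, b)\<in>E. closed_segment a b))"
    using \<open>finite E\<close> by (intro open_Compl closed_UN) auto
  ultimately obtain r where r: "r > 0" "ball m r \<subseteq> - (\<Union>(a, b)\<in>E. closed_segment a b)"
    unfolding open_contains_ball by blast
  have "closed_segment a b \<inter> ball m r = {}" if "(a, b) \<in> E" for a b
    using r(2) that by blast
  with m(1) r(1) show thesis by (rule that)
qed

definition complete_minus :: "'a set \<Rightarrow> 'a set set \<Rightarrow> 'a pair_pre_digraph" where
  "complete_minus V F = \<lparr>pverts = V, parcs = {(u, v). u \<in> V \<and> v \<in> V \<and> u \<noteq> v \<and> {u, v} \<notin> F}\<rparr>"

lemma pair_graph_complete_minus: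
  assumes "finite V"
  shows "pair_graph (complete_minus V F)"
proof
  show "finite (parcs (complete_minus V F))"
    by (rule finite_subset[of _ "V \<times> V"]) (auto simp: complete_minus_def assms)
qed (auto simp: complete_minus_def assms symmetric_def sym_def insert_commute)

lemma exists_ball_meeting_single_edge:
  assumes "finite V" and gen: "generic_on V p" and uv: "u \<in> V" "v \<in> V" "u \<noteq> v"
  obtains m r where "m \<in> open_segment (p u) (p v)" "r > 0"
    "\<And>a b. \<lbrakk>a \<in> V; b \<in> V; a \<noteq> b; {a, b} \<noteq> {u, v}\<rbrakk> \<Longrightarrow> closed_segment (p a) (p b) \<inter> ball m r = {}"
proof -
  define E where "E = (\<lambda>(a, b). (p a, p b)) ` (V \<times> V - {(a, b). a = b \<or> {a, b} = {u, v}})"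
  have "finite E" by (simp add: E_def \<open>finite V\<close>)
  have "orient (p u) (p v) s \<noteq> 0 \<or> orient (p u) (p v) t \<noteq> 0" if st: "(s, t) \<in> E" for s t
  proof -
    obtain a b where ab: "a \<in> V" "b \<in> V" "s = p a" "t = p b" "a \<notin> {u, v} \<or> b \<notin> {u, v}"
      using st by (auto simp: E_def)
    then show ?thesis
      using generic_on_orient[OF gen uv(1,2)] uv(3) by auto
  qed
  moreover have "p u \<noteq> p v" using gen uv by (auto simp: generic_on_def dest: inj_onD)
  ultimately obtain m r where m: "m \<in> open_segment (p u) (p v)" "r > 0"
    and off: "\<And>s t. (s, t) \<in> E \<Longrightarrow> closed_segment s t \<inter> ball m r = {}"
    using exists_ball_off_segments[OF \<open>finite E\<close>] by metis
  have "closed_segment (p a) (p b) \<inter> ball m r = {}"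
    if "a \<in> V" "b \<in> V" "a \<noteq> b" "{a, b} \<noteq> {u, v}" for a b
    using that by (intro off) (auto simp: E_def)
  with m show thesis by (rule that)
qed

lemma exists_blocking_triangle:
  assumes fin: "finite V" and gen: "generic_on V p" and X: "finite X" "general_position X"
    and uv: "u \<in> V" "v \<in> V" "u \<noteq> v"
  obtains T where "polygonal_obstacle T" "general_position (X \<union> region_vertices T)"
    "\<And>a b. \<lbrakk>a \<in> V; b \<in> V; a \<noteq> b\<rbrakk> \<Longrightarrow> closed_segment (p a) (p b) \<inter> T \<noteq> {} \<longleftrightarrow> {a, b} = {u, v}"
proof -
  obtain m r where m: "m \<in> open_segment (p u) (p v)" and "r > 0"
    and off: "\<And>a b. \<lbrakk>a \<in> V; b \<in> V; a \<noteq> b; {a, b} \<noteq> {u, v}\<rbrakk>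
      \<Longrightarrow> closed_segment (p a) (p b) \<inter> ball m r = {}"
    using exists_ball_meeting_single_edge[OF fin gen uv] by metis
  obtain x y z where xyz: "{x, y, z} \<subseteq> ball m r" "general_position (X \<union> {x, y, z})"
    and pos: "orient x y z > 0" and mT: "m \<in> convex hull {x, y, z}"
    using exists_generic_triangle_around[OF X \<open>r > 0\<close>] by metis
  let ?T = "convex hull {x, y, z}"
  have T_ball: "?T \<subseteq> ball m r" using xyz(1) by (intro hull_minimal convex_ball)
  show thesis
  proof (rule that)
    show "polygonal_obstacle ?T" by (rule polygonal_obstacle_triangle[OF pos])
    show "general_position (X \<union> region_vertices ?T)"
      using region_vertices_triangle[OF pos] by (intro general_position_mono[OF xyz(2)]) blast
    show "closed_segment (p a) (p b) \<inter> ?T \<noteq> {} \<longleftrightarrow> {a, b} = {u, v}"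
      if ab: "a \<in> V" "b \<in> V" "a \<noteq> b" for a b
    proof (cases "{a, b} = {u, v}")
      case True
      then have "m \<in> closed_segment (p a) (p b)"
        using subsetD[OF segment_open_subset_closed m]
        by (metis closed_segment_commute doubleton_eq_iff)
      then show ?thesis using True mT by blast
    next
      case False
      then have "closed_segment (p a) (p b) \<inter> ?T = {}" using off[OF ab] T_ball by blast
      then show ?thesis using False by simp
    qed
  qed
qed

lemma obstacle_representation_delete_edge:
  assumes fin: "finite V" and rep: "obstacle_representation (complete_minus V F) p \<O>"
    and uv: "u \<in> V" "v \<in> V" "u \<noteq> v"
  shows "\<exists>T. obstacle_representation (complete_minus V (insert {u, v} F)) p (insert T \<O>)"
proof -
  define X where "X = p ` V \<union> (\<Union>S\<in>\<O>. region_vertices S)"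
  have p: "inj_on p V" and \<O>: "finite \<O>" "\<And>S. S \<in> \<O> \<Longrightarrow> polygonal_obstacle S"
    and gp: "general_position X"
    and adj: "\<And>a b. \<lbrakk>a \<in> V; b \<in> V; a \<noteq> b\<rbrakk> \<Longrightarrow> {a, b} \<notin> F \<longleftrightarrow> (\<forall>S\<in>\<O>. closed_segment (p a) (p b) \<inter> S = {})"
    using rep by (auto simp: obstacle_representation_def complete_minus_def X_def)
  have "general_position (p ` V)"
    by (rule general_position_mono[OF gp]) (simp add: X_def)
  then have gen: "generic_on V p" using p by (simp add: generic_on_def)
  have "finite X"
    using fin \<O> finite_region_vertices by (auto simp: X_def polygonal_obstacle_def)
  then obtain T where T: "polygonal_obstacle T" "general_position (X \<union> region_vertices T)"
    and blocks: "\<And>a b. \<lbrakk>a \<in> V; b \<in> V; a \<noteq> b\<rbrakk> \<Longrightarrow> closed_segment (p a) (p b) \<inter> T \<noteq> {} \<longleftrightarrow> {a, b} = {u, v}"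
    using exists_blocking_triangle[OF fin gen _ gp uv] by blast
  have "X \<union> region_vertices T = p ` V \<union> (\<Union>S\<in>insert T \<O>. region_vertices S)"
    by (auto simp: X_def)
  moreover have "{a, b} \<notin> insert {u, v} F \<longleftrightarrow> (\<forall>S\<in>insert T \<O>. closed_segment (p a) (p b) \<inter> S = {})"
    if "a \<in> V" "b \<in> V" "a \<noteq> b" for a b
    using adj[OF that] blocks[OF that] by blast
  ultimately have "obstacle_representation (complete_minus V (insert {u, v} F)) p (insert T \<O>)"
    using p \<O> T unfolding obstacle_representation_def complete_minus_def by simp
  then show ?thesis by blast
qed

lemma obs_le: "obstacle_representation G p \<O> \<Longrightarrow> obs G \<le> enat (card \<O>)"
  unfolding obs_def by (rule INF_lower) blast

lemma obs_attained:
  assumes "obs G \<noteq> \<infinity>"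
  obtains p \<O> where "obstacle_representation G p \<O>" "obs G = enat (card \<O>)"
proof -
  let ?N = "(\<lambda>\<O>. enat (card \<O>)) ` {\<O>. \<exists>p. obstacle_representation G p \<O>}"
  have "?N \<noteq> {}" using assms unfolding obs_def by (metis Inf_empty top_enat_def)
  then have "obs G \<in> ?N" unfolding obs_def by (metis ex_in_conv wellorder_InfI)
  then show thesis using that by blast
qed

lemma obs_delete_edge:
  assumes "finite V"
  shows "obs (complete_minus V (insert e F)) \<le> obs (complete_minus V F) + 1"
proof (cases "\<exists>u\<in>V. \<exists>v\<in>V. u \<noteq> v \<and> e = {u, v}")
  case False
  then have "complete_minus V (insert e F) = complete_minus V F"
    unfolding complete_minus_def by auto
  then show ?thesis by simp
next
  case True
  then obtain u v where uv: "u \<in> V" "v \<in> V" "u \<noteq> v" and e: "e = {u, v}" by blast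
  show ?thesis
  proof (cases "obs (complete_minus V F) = \<infinity>")
    case False
    then obtain p \<O> where rep: "obstacle_representation (complete_minus V F) p \<O>"
      and card: "obs (complete_minus V F) = enat (card \<O>)"
      by (rule obs_attained)
    obtain T where "obstacle_representation (complete_minus V (insert e F)) p (insert T \<O>)"
      using obstacle_representation_delete_edge[OF assms rep uv] e by blast
    then have "obs (complete_minus V (insert e F)) \<le> enat (card (insert T \<O>))" by (rule obs_le)
    also have "\<dots> \<le> enat (card \<O> + 1)" by (simp add: card_insert_le_m1)
    finally show ?thesis by (simp add: card one_enat_def)
  qed simp
qed

lemma general_position_parabola: "general_position ((\<lambda>x. vector [x, x\<^sup>2]) ` X)"
proof -
  have "orient (vector [x, x\<^sup>2]) (vector [y, y\<^sup>2]) (vector [z, z\<^sup>2]) =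
      (y - x) * (z - x) * (z - y)" for x y z :: real
    by (simp add: orient_def power2_eq_square algebra_simps)
  then show ?thesis
    unfolding general_position_def collinear_iff_orient by auto
qed

lemma obs_complete:
  assumes "finite V"
  shows "obs (complete_minus V {}) = 0"
proof -
  obtain f :: "'a \<Rightarrow> nat" where f: "inj_on f V"
    using finite_imp_inj_to_nat_seg[OF assms] by blast
  define p :: "'a \<Rightarrow> real^2" where "p v = vector [real (f v), (real (f v))\<^sup>2]" for v
  have "p ` V = (\<lambda>x. vector [x, x\<^sup>2]) ` (\<lambda>v. real (f v)) ` V"
    by (simp add: p_def image_image)
  then have "general_position (p ` V)" by (simp only: general_position_parabola)
  moreover have "inj_on p V" using f by (auto simp: inj_on_def vec2_eq_iff p_def)
  ultimately have "obstacle_representation (complete_minus V {}) p {}"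
    by (simp add: obstacle_representation_def complete_minus_def)
  from obs_le[OF this] show ?thesis by (simp flip: zero_enat_def)
qed

lemma obs_intermediate_value:
  assumes "finite V" "finite F" "enat h \<le> obs (complete_minus V F)"
  shows "\<exists>F'. obs (complete_minus V F') = enat h"
  using assms(2,3)
proof (induction F rule: finite_induct)
  case empty
  then have "obs (complete_minus V {}) = enat h"
    by (simp add: obs_complete[OF assms(1)] zero_enat_def)
  then show ?case by blast
next
  case (insert e F)
  show ?case
  proof (cases "enat h \<le> obs (complete_minus V F)")
    case False
    then have "obs (complete_minus V F) + 1 \<le> enat h"
      by (simp add: not_le ileI1 plus_1_eSuc)
    then have "obs (complete_minus V (insert e F)) = enat h"
      using insert.prems obs_delete_edge[OF assms(1), of e F] by simp
    then show ?thesis by blast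
  qed (rule insert.IH)
qed

theorem theorem3:
  shows "\<forall>h::nat. \<exists>G :: nat pair_pre_digraph. pair_graph G \<and> obs G = enat h"
proof
  fix h :: nat
  let ?L = "lex_power {..<11::nat} (2 * h)" and ?adj = "lex_adj kernel_adj"
  define V :: "nat set" where "V = to_nat ` ?L"
  define F :: "nat set set"
    where "F = (\<lambda>(x, y). {to_nat x, to_nat y}) ` (?L \<times> ?L - {(x, y). ?adj x y})"
  have "finite V" "finite F" by (simp_all add: V_def F_def finite_lex_power)
  have "(to_nat x, to_nat y) \<in> parcs (complete_minus V F) \<longleftrightarrow> ?adj x y"
    if "x \<in> ?L" "y \<in> ?L" "x \<noteq> y" for x y
    using that sympD[OF symp_lex_adj[OF symp_kernel_adj]]
    by (auto simp: complete_minus_def V_def F_def doubleton_eq_iff)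
  then have "enat h \<le> obs (complete_minus V F)"
    by (intro obs_ge_if_induced_lex_power[OF forces_trap_kernel])
      (auto simp: complete_minus_def V_def)
  then show "\<exists>G :: nat pair_pre_digraph. pair_graph G \<and> obs G = enat h"
    using obs_intermediate_value[OF \<open>finite V\<close> \<open>finite F\<close>]
      pair_graph_complete_minus[OF \<open>finite V\<close>] by blast
qed

end
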